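(* Let $n\ge 2$ be an integer. Let $t_n\in(0,1)$ be the unique solution in $(0,1)$ of $\sum_{k=1}^n t_n^k/k=1$, and let $\mu_n:=2(1-t_n)$. Let $W:\mathbb{R}^2\to\mathbb{R}$ be a measurable function satisfying $W(q,p)\ge 0$ and $\pi W(q,p)\le 1$ for all $(q,p)$, and $\int_{\mathbb{R}^2} W(q,p)\,dq\,dp=1$, and let $\mu:=2\pi\int_{\mathbb{R}^2}W(q,p)^2\,dq\,dp$. If $\mu\le\mu_n$, then $$S[W]\ge 1+\ln\pi .$$
   Context: $S[W]:=-\int_{\mathbb{R}^2} W(q,p)\ln W(q,p)\,dq\,dp$ is the Shannon differential entropy of $W$ (the "Wigner entropy"), with the convention $0\ln 0=0$; since $0\le W\le 1/\pi<1$, it is well defined in $[0,+\infty]$. The quantity $\mu$ is called the purity of $W$. The number $t_n$ exists and is unique because $t\mapsto\sum_{k=1}^n t^k/k$ is continuous and strictly increasing on $[0,1]$, vanishes at $0$ and exceeds $1$ at $t=1$ for $n\ge2$. $W$ is not required to be the Wigner function of a quantum state. *)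

theory Defs
  imports "HOL-Analysis.Analysis"
begin

text \<open>
  Minus the Lebesgue integral of \<open>W ln W\<close> over the phase plane, as an extended real: the integral
  of the positive part of \<open>- W ln W\<close> minus the integral of its negative part.  A Bochner integral
  would not do here, since it is \<open>0\<close> when the entropy is infinite.  The convention \<open>0 ln 0 = 0\<close>
  holds because \<open>0 * x = 0\<close>.
\<close>

definition wigner_entropy :: "(real \<times> real \<Rightarrow> real) \<Rightarrow> ereal" where
  "wigner_entropy W =
     enn2ereal (\<integral>\<^sup>+ z. ennreal (- (W z * ln (W z))) \<partial>lebesgue)
     - enn2ereal (\<integral>\<^sup>+ z. ennreal (W z * ln (W z)) \<partial>lebesgue)"

text \<open>For \<open>0 \<le> W \<le> 1 / pi\<close> the negative part vanishes, so the difference is never \<open>\<infinity> - \<infinity>\<close>.\<close>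

lemma wigner_entropy_eq_nn_integral:
  assumes "\<And>z. 0 \<le> W z" and "\<And>z. pi * W z \<le> 1"
  shows "wigner_entropy W = enn2ereal (\<integral>\<^sup>+ z. ennreal (- (W z * ln (W z))) \<partial>lebesgue)"
proof -
  have "W z * ln (W z) \<le> 0" for z
  proof (cases "W z = 0")
    case False
    with assms(1)[of z] have pos: "0 < W z" by simp
    have "1 * W z \<le> pi * W z"
      using pi_gt3 assms(1)[of z] by (intro mult_right_mono) auto
    with assms(2)[of z] have "W z \<le> 1" by simp
    with pos have "ln (W z) \<le> 0" by simp
    with pos show ?thesis by (simp add: mult_nonneg_nonpos)
  qed simp
  then have "ennreal (W z * ln (W z)) = 0" for z by (simp add: ennreal_neg)
  then show ?thesis by (simp add: wigner_entropy_def zero_ennreal.rep_eq)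
qed

definition wigner_purity :: "(real \<times> real \<Rightarrow> real) \<Rightarrow> real" where
  "wigner_purity W = 2 * pi * (\<integral>z. (W z)\<^sup>2 \<partial>lebesgue)"

definition t_crit :: "nat \<Rightarrow> real" where
  "t_crit n = (THE t. 0 < t \<and> t < 1 \<and> (\<Sum>k=1..n. t ^ k / real k) = 1)"

definition mu_crit :: "nat \<Rightarrow> real" where
  "mu_crit n = 2 * (1 - t_crit n)"

lemma t_crit_ex1:
  assumes "n \<ge> 2"
  shows "\<exists>!t::real. 0 < t \<and> t < 1 \<and> (\<Sum>k=1..n. t ^ k / real k) = 1"
proof -
  define f where "f t = (\<Sum>k=1..n. t ^ k / real k)" for t :: real
  have mono: "f s < f t" if "0 \<le> s" "s < t" for s t
    unfolding f_def
  proof (rule sum_strict_mono)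
    fix k assume "k \<in> {1..n}"
    with that show "s ^ k / real k < t ^ k / real k"
      by (intro divide_strict_right_mono power_strict_mono) auto
  qed (use assms in auto)
  have f0: "f 0 = 0" unfolding f_def by (intro sum.neutral) auto
  have "(\<Sum>k\<in>{1,2}. (1::real) ^ k / real k) \<le> f 1"
    unfolding f_def using assms by (intro sum_mono2) auto
  then have f1: "f 1 > 1" by simp
  have "\<exists>t\<ge>0. t \<le> 1 \<and> f t = 1"
    using f0 f1 by (intro IVT') (auto simp: f_def intro!: continuous_intros)
  then obtain t where t: "0 \<le> t" "t \<le> 1" "f t = 1" by blast
  have "t \<noteq> 0" "t \<noteq> 1" using t f0 f1 by auto
  with t have "0 < t \<and> t < 1 \<and> f t = 1" by auto
  moreover have "s = t" if "0 < s \<and> s < 1 \<and> f s = 1" for s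
    using mono[of s t] mono[of t s] that t by (cases s t rule: linorder_cases) auto
  ultimately show ?thesis unfolding f_def by blast
qed

end

theory Submission
  imports Defs
begin

text \<open>
  Put \<open>c = \<mu>\<^sub>n / 2 = 1 - t\<^sub>n\<close>. The tangent line of the logarithm at \<open>c\<close>, evaluated at \<open>\<pi> W\<close>, gives
  \<open>- W ln W \<ge> W (ln \<pi> - ln c + 1 - \<pi> W / c)\<close>. The right-hand side integrates to
  \<open>ln \<pi> - ln c + 1 - \<mu> / (2 c)\<close>, which is at least \<open>ln \<pi> - ln c\<close> when \<open>\<mu> \<le> \<mu>\<^sub>n\<close>. Finally
  \<open>- ln c = - ln (1 - t\<^sub>n)\<close> dominates its Taylor polynomial at \<open>t\<^sub>n\<close>, whose value is \<open>1\<close>.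
\<close>

text \<open>Both sides agree at \<open>0\<close>. Summing the geometric series shows that their
  difference has derivative \<open>s ^ n / (1 - s)\<close>, which is nonnegative on
  \<open>[0, t]\<close>.\<close>

lemma sum_power_div_le_neg_ln:
  fixes t :: real
  assumes "0 \<le> t" "t < 1"
  shows "(\<Sum>k=1..n. t ^ k / real k) \<le> - ln (1 - t)"
proof -
  define f where "f s = - ln (1 - s) - (\<Sum>k=1..n. s ^ k / real k)" for s :: real
  have "\<exists>y. (f has_real_derivative y) (at s) \<and> 0 \<le> y" if "0 \<le> s" "s \<le> t" for s
  proof (intro exI conjI)
    have s: "s < 1" using that assms by simp
    have deriv: "(f has_real_derivative 1 / (1 - s) - (\<Sum>k=1..n. s ^ (k - 1))) (at s)"
      unfolding f_def
      by (rule derivative_eq_intros refl | use s in force)+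
    have "(\<Sum>k=1..n. s ^ (k - 1)) = (\<Sum>k<n. s ^ k)"
      by (rule sum.reindex_bij_witness[of _ Suc "\<lambda>k. k - 1"]) auto
    also have "\<dots> = (1 - s ^ n) / (1 - s)"
      using s by (simp add: sum_gp_strict)
    also have "\<dots> \<le> 1 / (1 - s)"
      using s that by (intro divide_right_mono) auto
    finally show "0 \<le> 1 / (1 - s) - (\<Sum>k=1..n. s ^ (k - 1))" by simp
    show "(f has_real_derivative 1 / (1 - s) - (\<Sum>k=1..n. s ^ (k - 1))) (at s)"
      by (rule deriv)
  qed
  then have "f 0 \<le> f t"
    by (intro DERIV_nonneg_imp_nondecreasing[OF assms(1)])
  moreover have "(\<Sum>k=1..n. (0::real) ^ k / real k) = 0" by (intro sum.neutral) auto
  ultimately show ?thesis by (simp add: f_def)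
qed

lemma t_crit_props:
  assumes "n \<ge> 2"
  shows "0 < t_crit n" "t_crit n < 1" "(\<Sum>k=1..n. t_crit n ^ k / real k) = 1"
  using theI'[OF t_crit_ex1[OF assms]] unfolding t_crit_def by auto

lemma ln_le_tangent:
  fixes x c :: real
  assumes "0 < x" "0 < c"
  shows "ln x \<le> ln c + x / c - 1"
  using ln_le_minus_one[of "x / c"] assms by (simp add: ln_div)

text \<open>Replacing \<open>g\<close> by its positive part turns the Bochner integral into a
  nonnegative one. The right-hand side may be infinite, which covers infinite entropy.\<close>

lemma integral_le_nn_integral:
  fixes g h :: "'a \<Rightarrow> real"
  assumes "integrable M g" and "\<And>x. g x \<le> h x"
  shows "ennreal (\<integral>x. g x \<partial>M) \<le> (\<integral>\<^sup>+x. ennreal (h x) \<partial>M)"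
proof -
  have int: "integrable M (\<lambda>x. max 0 (g x))"
    using assms(1) by auto
  have "ennreal (\<integral>x. g x \<partial>M) \<le> ennreal (\<integral>x. max 0 (g x) \<partial>M)"
    by (intro ennreal_leI integral_mono assms(1) int) simp
  also have "\<dots> = (\<integral>\<^sup>+x. ennreal (max 0 (g x)) \<partial>M)"
    by (rule nn_integral_eq_integral[symmetric]) (use int in auto)
  also have "\<dots> \<le> (\<integral>\<^sup>+x. ennreal (h x) \<partial>M)"
    using assms(2) by (intro nn_integral_mono) (simp add: ennreal_leI max_def ennreal_neg)
  finally show ?thesis .
qed

theorem mainTheorem3:
  fixes n :: nat and W :: "real \<times> real \<Rightarrow> real"
  assumes "n \<ge> 2"
    and "W \<in> borel_measurable lebesgue"
    and "\<And>q p. W (q, p) \<ge> 0"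
    and "\<And>q p. pi * W (q, p) \<le> 1"
    and "(\<integral>z. W z \<partial>lebesgue) = 1"
    and "wigner_purity W \<le> mu_crit n"
  shows "wigner_entropy W \<ge> ereal (1 + ln pi)"
proof -
  have W0: "0 \<le> W z" and W1: "pi * W z \<le> 1" for z
    using assms(3,4) by (cases z, simp)+
  note t = t_crit_props[OF assms(1)]
  define c where "c = 1 - t_crit n"
  have c: "0 < c" using t by (simp add: c_def)
  have ln_c: "1 \<le> - ln c"
    using sum_power_div_le_neg_ln[of "t_crit n" n] t by (simp add: c_def)
  \<comment> \<open>The Bochner integral of a non-integrable function is \<open>0\<close>, so the
    value \<open>1\<close> forces integrability.\<close>
  have intW: "integrable lebesgue W"
    using assms(5) not_integrable_integral_eq by fastforce
  \<comment> \<open>Since \<open>W z \<le> 1\<close>, the integrable \<open>W\<close> dominates its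
    square, so the purity is a genuine integral and not the default \<open>0\<close>.\<close>
  have "(W z)\<^sup>2 \<le> W z" for z
  proof -
    have "1 * W z \<le> pi * W z"
      using W0 pi_gt3 by (intro mult_right_mono) auto
    with W1[of z] show ?thesis
      using W0[of z] by (simp add: power2_eq_square mult_left_le)
  qed
  then have intW2: "integrable lebesgue (\<lambda>z. (W z)\<^sup>2)"
    by (intro Bochner_Integration.integrable_bound[OF intW] borel_measurable_power assms(2))
       (auto simp: W0)
  \<comment> \<open>The tangent bound multiplied out: normalization and purity alone determine the
    integral of \<open>g\<close>.\<close>
  define g where "g z = (ln pi - ln c + 1) * W z - pi / c * (W z)\<^sup>2" for z
  have intg: "integrable lebesgue g"
    unfolding g_def using intW intW2 by auto
  have g_le: "g z \<le> - (W z * ln (W z))" for z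
  proof (cases "W z = 0")
    case False
    with W0[of z] have pos: "0 < W z" by simp
    have "ln pi + ln (W z) \<le> ln c + pi * W z / c - 1"
      using ln_le_tangent[of "pi * W z" c] pos c by (simp add: ln_mult)
    then have "W z * (ln pi - ln c + 1 - pi * W z / c) \<le> W z * (- ln (W z))"
      using pos by (intro mult_left_mono) auto
    then show ?thesis by (simp add: g_def algebra_simps power2_eq_square)
  qed (simp add: g_def)
  have "pi * (\<integral>z. (W z)\<^sup>2 \<partial>lebesgue) \<le> c"
    using assms(6) by (simp add: wigner_purity_def mu_crit_def c_def)
  then have "pi / c * (\<integral>z. (W z)\<^sup>2 \<partial>lebesgue) \<le> 1"
    using c by (simp add: field_simps)
  moreover have "(\<integral>z. g z \<partial>lebesgue)
      = (ln pi - ln c + 1) - pi / c * (\<integral>z. (W z)\<^sup>2 \<partial>lebesgue)"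
    unfolding g_def using intW intW2 assms(5) by simp
  ultimately have "1 + ln pi \<le> (\<integral>z. g z \<partial>lebesgue)"
    using ln_c by simp
  then have "ennreal (1 + ln pi) \<le> ennreal (\<integral>z. g z \<partial>lebesgue)"
    by (rule ennreal_leI)
  also have "\<dots> \<le> (\<integral>\<^sup>+z. ennreal (- (W z * ln (W z))) \<partial>lebesgue)"
    by (rule integral_le_nn_integral[OF intg g_le])
  finally have "enn2ereal (ennreal (1 + ln pi)) \<le> wigner_entropy W"
    unfolding wigner_entropy_eq_nn_integral[of W, OF W0 W1] less_eq_ennreal.rep_eq .
  \<comment> \<open>\<open>ennreal\<close> sends negative reals to \<open>0\<close>, so going back
    to \<open>ereal\<close> requires this sign.\<close>
  moreover have "0 \<le> 1 + ln pi" using pi_gt3 by (simp add: add_nonneg_nonneg)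
  ultimately show ?thesis by (simp add: enn2ereal_ennreal)
qed

end
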